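(* Let $\mathrm{uAs}_{pl}$ be the terminal (single-coloured) planar operad in sets, having exactly one operation $\mu_n$ of each arity $n\ge 0$. The twisted arrow category $\mathrm{Tw}_{\mathrm{pOp}}(\mathrm{uAs}_{pl})$ and the enveloping category $\mathcal U_{\mathrm{pOp}}(\mathrm{uAs}_{pl})$ are isomorphic to the simplex category $\Delta$.
   Context: For a single-coloured planar operad $P$ in sets (no symmetric group actions) the category $\mathrm{Tw}_{\mathrm{pOp}}(P)$ is the following one. Objects are the operations of $P$. A morphism with source an operation $p$ of arity $n$ is a tuple $(q_0,i;q_1,\dots,q_n)$, where $q_0,\dots,q_n$ are operations of $P$ and $1\le i\le\mathrm{arity}(q_0)$; its target is $q_0\circ_i p(q_1,\dots,q_n)$. So it is a planar tree with source vertex $p$ attached to the $i$-th input of the lower vertex $q_0$ and with $q_1,\dots,q_n$ attached to the inputs of $p$. The composite of such a morphism $p\to t$ with a morphism from $t$ is given by grafting the lower and upper vertices of the second morphism onto the root and the leaves of the tree of the first one, and composing in $P$ all edges not adjacent to $p$. Identity morphisms have all $q_j$ equal to the identity operation. The enveloping category $\mathcal U_{\mathrm{pOp}}(P)$ has natural numbers $n\ge0$ (arities) as objects and the same tuples as morphisms, with the source vertex of arity $n$ being unmarked; the target is the resulting arity. $\Delta$ is the category of the ordered sets $[n]=\{0,\dots,n\}$, $n\geq 0$, and weakly monotone maps. *)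

theory Defs
  imports Main "HOL-Library.FuncSet"
begin

section \<open>Categories and isomorphism of categories\<close>

text \<open>\<open>Comp C g f\<close> is the composite of \<open>f\<close> followed by \<open>g\<close>; it is only meaningful when
  \<open>Cod C f = Dom C g\<close>.\<close>

record ('o, 'm) cat =
  Obj :: "'o set"
  Arr :: "'m set"
  Dom :: "'m \<Rightarrow> 'o"
  Cod :: "'m \<Rightarrow> 'o"
  Id :: "'o \<Rightarrow> 'm"
  Comp :: "'m \<Rightarrow> 'm \<Rightarrow> 'm"

locale category =
  fixes C :: "('o, 'm) cat"
  assumes Dom_in: "f \<in> Arr C \<Longrightarrow> Dom C f \<in> Obj C"
    and Cod_in: "f \<in> Arr C \<Longrightarrow> Cod C f \<in> Obj C"
    and Id_in: "x \<in> Obj C \<Longrightarrow> Id C x \<in> Arr C"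
    and Dom_Id: "x \<in> Obj C \<Longrightarrow> Dom C (Id C x) = x"
    and Cod_Id: "x \<in> Obj C \<Longrightarrow> Cod C (Id C x) = x"
    and Comp_in: "\<lbrakk>f \<in> Arr C; g \<in> Arr C; Cod C f = Dom C g\<rbrakk> \<Longrightarrow> Comp C g f \<in> Arr C"
    and Dom_Comp: "\<lbrakk>f \<in> Arr C; g \<in> Arr C; Cod C f = Dom C g\<rbrakk> \<Longrightarrow> Dom C (Comp C g f) = Dom C f"
    and Cod_Comp: "\<lbrakk>f \<in> Arr C; g \<in> Arr C; Cod C f = Dom C g\<rbrakk> \<Longrightarrow> Cod C (Comp C g f) = Cod C g"
    and Comp_Id_right: "f \<in> Arr C \<Longrightarrow> Comp C f (Id C (Dom C f)) = f"
    and Comp_Id_left: "f \<in> Arr C \<Longrightarrow> Comp C (Id C (Cod C f)) f = f"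
    and Comp_assoc: "\<lbrakk>f \<in> Arr C; g \<in> Arr C; h \<in> Arr C; Cod C f = Dom C g; Cod C g = Dom C h\<rbrakk>
      \<Longrightarrow> Comp C h (Comp C g f) = Comp C (Comp C h g) f"

locale cat_functor = C: category C + D: category D
  for C :: "('o, 'm) cat" and D :: "('p, 'n) cat" +
  fixes Fo :: "'o \<Rightarrow> 'p" and Fm :: "'m \<Rightarrow> 'n"
  assumes Fo_in: "x \<in> Obj C \<Longrightarrow> Fo x \<in> Obj D"
    and Fm_in: "f \<in> Arr C \<Longrightarrow> Fm f \<in> Arr D"
    and Dom_Fm: "f \<in> Arr C \<Longrightarrow> Dom D (Fm f) = Fo (Dom C f)"
    and Cod_Fm: "f \<in> Arr C \<Longrightarrow> Cod D (Fm f) = Fo (Cod C f)"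
    and Fm_Id: "x \<in> Obj C \<Longrightarrow> Fm (Id C x) = Id D (Fo x)"
    and Fm_Comp: "\<lbrakk>f \<in> Arr C; g \<in> Arr C; Cod C f = Dom C g\<rbrakk>
      \<Longrightarrow> Fm (Comp C g f) = Comp D (Fm g) (Fm f)"

definition isomorphic_categories :: "('o, 'm) cat \<Rightarrow> ('p, 'n) cat \<Rightarrow> bool" where
  "isomorphic_categories C D \<longleftrightarrow>
    (\<exists>Fo Fm Go Gm. cat_functor C D Fo Fm \<and> cat_functor D C Go Gm \<and>
      (\<forall>x \<in> Obj C. Go (Fo x) = x) \<and> (\<forall>f \<in> Arr C. Gm (Fm f) = f) \<and>
      (\<forall>y \<in> Obj D. Fo (Go y) = y) \<and> (\<forall>g \<in> Arr D. Fm (Gm g) = g))"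

section \<open>The simplex category\<close>

text \<open>The object \<open>n\<close> stands for \<open>[n] = {0..n}\<close>. The arrow \<open>(m, f, n)\<close> is a weakly monotone map
  \<open>[m] \<rightarrow> [n]\<close>; \<open>f\<close> is normalised to \<open>undefined\<close> outside \<open>[m]\<close>, so that equality of triples is
  equality of maps.\<close>

definition Simplex :: "(nat, nat \<times> (nat \<Rightarrow> nat) \<times> nat) cat" where
  "Simplex = \<lparr>
    Obj = UNIV,
    Arr = {(m, f, n). f \<in> {0..m} \<rightarrow>\<^sub>E {0..n} \<and> mono_on {0..m} f},
    Dom = (\<lambda>(m, f, n). m),
    Cod = (\<lambda>(m, f, n). n),
    Id = (\<lambda>n. (n, \<lambda>x\<in>{0..n}. x, n)),
    Comp = (\<lambda>(m', g, n') (m, f, n). (m, compose {0..m} g f, n'))\<rparr>"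

section \<open>Planar operads in sets\<close>

text \<open>\<open>ops P\<close> is the disjoint union of the sets of operations of the various arities, and
  \<open>gam P p [q\<^sub>1, \<dots>, q\<^sub>n]\<close> is the total composition \<open>p(q\<^sub>1, \<dots>, q\<^sub>n)\<close>, meaningful for
  \<open>n = arity P p\<close>.\<close>

record 'a operad =
  ops :: "'a set"
  arity :: "'a \<Rightarrow> nat"
  idop :: 'a
  gam :: "'a \<Rightarrow> 'a list \<Rightarrow> 'a"

locale planar_operad =
  fixes P :: "'a operad"
  assumes idop_in: "idop P \<in> ops P"
    and arity_idop: "arity P (idop P) = 1"
    and gam_in: "\<lbrakk>p \<in> ops P; set qs \<subseteq> ops P; length qs = arity P p\<rbrakk> \<Longrightarrow> gam P p qs \<in> ops P"
    and arity_gam: "\<lbrakk>p \<in> ops P; set qs \<subseteq> ops P; length qs = arity P p\<rbrakk>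
      \<Longrightarrow> arity P (gam P p qs) = sum_list (map (arity P) qs)"
    and gam_idop_right: "p \<in> ops P \<Longrightarrow> gam P p (replicate (arity P p) (idop P)) = p"
    and gam_idop_left: "p \<in> ops P \<Longrightarrow> gam P (idop P) [p] = p"
    and gam_assoc: "\<lbrakk>p \<in> ops P; set qs \<subseteq> ops P; length qs = arity P p;
        list_all2 (\<lambda>q rs. set rs \<subseteq> ops P \<and> length rs = arity P q) qs rss\<rbrakk>
      \<Longrightarrow> gam P (gam P p qs) (concat rss) = gam P p (map2 (gam P) qs rss)"

text \<open>The partial composition \<open>p \<circ>\<^sub>i q\<close>, for \<open>1 \<le> i \<le> arity P p\<close>.\<close>

definition pcomp :: "'a operad \<Rightarrow> 'a \<Rightarrow> nat \<Rightarrow> 'a \<Rightarrow> 'a" where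
  "pcomp P p i q =
    gam P p (replicate (i - 1) (idop P) @ [q] @ replicate (arity P p - i) (idop P))"

section \<open>The twisted arrow category and the enveloping category\<close>

type_synonym 'a tuple = "'a \<times> nat \<times> 'a list"

definition tuples :: "'a operad \<Rightarrow> 'a tuple set" where
  "tuples P = {(q0, i, qs). q0 \<in> ops P \<and> 1 \<le> i \<and> i \<le> arity P q0 \<and> set qs \<subseteq> ops P}"

definition id_tuple :: "'a operad \<Rightarrow> nat \<Rightarrow> 'a tuple" where
  "id_tuple P n = (idop P, 1, replicate n (idop P))"

text \<open>\<open>blocks [n\<^sub>1, \<dots>, n\<^sub>k] xs\<close> cuts an initial segment of \<open>xs\<close> into consecutive lists of
  lengths \<open>n\<^sub>1, \<dots>, n\<^sub>k\<close>.\<close>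

primrec blocks :: "nat list \<Rightarrow> 'b list \<Rightarrow> 'b list list" where
  "blocks [] xs = []"
| "blocks (n # ns) xs = take n xs # blocks ns (drop n xs)"

text \<open>Composite of the tuple \<open>(q0, i, qs)\<close> followed by \<open>(r0, k, rs)\<close>. The leaves of the first tree
  are, from left to right, the first \<open>i - 1\<close> inputs of \<open>q0\<close>, the inputs of the members of \<open>qs\<close>, and
  the inputs of \<open>q0\<close> after the \<open>i\<close>-th; \<open>rs\<close> is cut accordingly. The new lower vertex is
  \<open>r0 \<circ>\<^sub>k q0(as, 1, cs)\<close>, and the source vertex sits on its input following the inputs of \<open>as\<close> and
  the first \<open>k - 1\<close> inputs of \<open>r0\<close>.\<close>

definition comp_tuple :: "'a operad \<Rightarrow> 'a tuple \<Rightarrow> 'a tuple \<Rightarrow> 'a tuple" where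
  "comp_tuple P = (\<lambda>(r0, k, rs) (q0, i, qs).
    let as = take (i - 1) rs;
        bss = blocks (map (arity P) qs) (drop (i - 1) rs);
        cs = drop (i - 1 + sum_list (map (arity P) qs)) rs
    in (pcomp P r0 k (gam P q0 (as @ [idop P] @ cs)),
        k + sum_list (map (arity P) as),
        map2 (gam P) qs bss))"

text \<open>The arrow \<open>(p, q0, i, qs)\<close> is the tuple \<open>(q0, i, qs)\<close> with source \<open>p\<close>.\<close>

definition Tw :: "'a operad \<Rightarrow> ('a, 'a \<times> 'a tuple) cat" where
  "Tw P = \<lparr>
    Obj = ops P,
    Arr = {(p, q0, i, qs). p \<in> ops P \<and> (q0, i, qs) \<in> tuples P \<and> length qs = arity P p},
    Dom = (\<lambda>(p, q0, i, qs). p),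
    Cod = (\<lambda>(p, q0, i, qs). pcomp P q0 i (gam P p qs)),
    Id = (\<lambda>p. (p, id_tuple P (arity P p))),
    Comp = (\<lambda>(t, y) (p, x). (p, comp_tuple P y x))\<rparr>"

text \<open>Here the source is the number of upper vertices, hence determined by the tuple.\<close>

definition Env :: "'a operad \<Rightarrow> (nat, 'a tuple) cat" where
  "Env P = \<lparr>
    Obj = UNIV,
    Arr = tuples P,
    Dom = (\<lambda>(q0, i, qs). length qs),
    Cod = (\<lambda>(q0, i, qs). arity P q0 - 1 + sum_list (map (arity P) qs)),
    Id = id_tuple P,
    Comp = comp_tuple P\<rparr>"

section \<open>The terminal planar operad\<close>

locale uAs_pl = planar_operad P for P :: "'a operad" +
  assumes unique_op: "\<exists>!p. p \<in> ops P \<and> arity P p = n"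

locale operad_morphism = Q: planar_operad Q + P: planar_operad P
  for Q :: "'b operad" and P :: "'a operad" +
  fixes h :: "'b \<Rightarrow> 'a"
  assumes h_in: "q \<in> ops Q \<Longrightarrow> h q \<in> ops P"
    and arity_h: "q \<in> ops Q \<Longrightarrow> arity P (h q) = arity Q q"
    and h_idop: "h (idop Q) = idop P"
    and h_gam: "\<lbrakk>q \<in> ops Q; set qs \<subseteq> ops Q; length qs = arity Q q\<rbrakk>
      \<Longrightarrow> h (gam Q q qs) = gam P (h q) (map h qs)"

lemma (in uAs_pl) op_eqI:
  "\<lbrakk>p \<in> ops P; q \<in> ops P; arity P p = arity P q\<rbrakk> \<Longrightarrow> p = q"
  using unique_op by blast

lemma (in uAs_pl) terminal:
  fixes Q :: "'b operad"
  assumes "planar_operad Q"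
  shows "\<exists>h. operad_morphism Q P h \<and>
    (\<forall>h'. operad_morphism Q P h' \<longrightarrow> (\<forall>q \<in> ops Q. h' q = h q))"
proof -
  interpret Q: planar_operad Q by fact
  define h where "h q = (THE p. p \<in> ops P \<and> arity P p = arity Q q)" for q
  have h: "h q \<in> ops P" "arity P (h q) = arity Q q" for q
    unfolding h_def using theI'[OF unique_op[of "arity Q q"]] by auto
  have mor: "operad_morphism Q P h"
  proof (unfold_locales, goal_cases)
    case 3
    show ?case
      by (rule op_eqI) (simp_all add: h idop_in arity_idop Q.arity_idop)
  next
    case (4 q qs)
    have *: "set (map h qs) \<subseteq> ops P" "length (map h qs) = arity P (h q)"
      using 4 by (auto simp: h)
    show ?case
      by (rule op_eqI)
        (use 4 * in \<open>simp_all add: h gam_in arity_gam Q.arity_gam o_def\<close>)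
  qed (simp_all add: h)
  have "h' q = h q" if "operad_morphism Q P h'" "q \<in> ops Q" for h' q
    using that by (intro op_eqI) (auto simp: h operad_morphism.h_in operad_morphism.arity_h)
  with mor show ?thesis by blast
qed

lemma sum_list_concat: "sum_list (concat xss) = sum_list (map sum_list (xss :: nat list list))"
  by (induction xss) simp_all

lemma uAs_pl_exists:
  "uAs_pl \<lparr>ops = UNIV, arity = (\<lambda>n. n), idop = 1, gam = (\<lambda>_ ks. sum_list ks)\<rparr>"
proof (unfold_locales, goal_cases)
  case (7 p qs rss)
  then have "length qs = length rss" by (simp add: list_all2_lengthD)
  then have "map2 (\<lambda>_. sum_list) qs rss = map sum_list rss"
    by (induction qs rss rule: list_induct2) simp_all
  then show ?case by (simp add: sum_list_concat)
qed (simp_all add: sum_list_replicate)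

end

theory Submission
  imports Defs
begin

text \<open>A tuple \<open>(q\<^sub>0, i; q\<^sub>1, \<dots>, q\<^sub>n)\<close> over any planar operad yields a monotone map
  \<open>f : [n] \<rightarrow> [N]\<close>, where \<open>N\<close> is the number of leaves of the two-level tree. Between and around
  the \<open>n\<close> inputs of the source vertex there are \<open>n + 1\<close> gaps, between and around the \<open>N\<close> leaves
  there are \<open>N + 1\<close> gaps, and each gap of the source vertex opens into one gap between the leaves:
  \<open>f j\<close> is the number of leaves to its left, that is, \<open>(i - 1) + |q\<^sub>1| + \<dots> + |q\<^sub>j|\<close>,
  where \<open>|q|\<close> is the arity of \<open>q\<close>.
  Read in terms of gaps, grafting of trees is composition of maps, because the leaves to the left of
  a gap in the composite tree are found by passing first to a gap of the inner tree and then to a gap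
  of the outer one (lemma \<open>tuple_map_comp\<close>).

  Conversely, \<open>f\<close> remembers exactly the arities occurring in the tuple: \<open>i - 1 = f 0\<close>,
  \<open>|q\<^sub>j| = f j - f (j - 1)\<close> and \<open>|q\<^sub>0| - i = N - f n\<close>, and these are arbitrary natural
  numbers. Over the terminal operad an operation is its arity, so tuples and monotone maps
  correspond bijectively (lemma \<open>bij_tuple_map\<close>), and the enveloping category is the simplex
  category. In the twisted arrow category an arrow carries in addition its source operation, which is
  determined by its arity \<open>n\<close>; so this category is isomorphic to the enveloping category.

  The category axioms for both categories come for free: they can be transported along these
  bijections (lemma \<open>isomorphic_categoriesI\<close>) from the simplex category.\<close>

section \<open>Isomorphisms of categories\<close>

text \<open>The laws of a category hold in \<open>C\<close> because they hold in \<open>D\<close> after applying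
  the injective maps \<open>Fo\<close> and \<open>Fm\<close>; so only closure of \<open>C\<close> under its operations has to
  be checked in \<open>C\<close> itself.\<close>

lemma isomorphic_categoriesI:
  assumes D: "category D"
    and Fo: "bij_betw Fo (Obj C) (Obj D)"
    and Fm: "bij_betw Fm (Arr C) (Arr D)"
    and Dom_in: "\<And>f. f \<in> Arr C \<Longrightarrow> Dom C f \<in> Obj C"
    and Cod_in: "\<And>f. f \<in> Arr C \<Longrightarrow> Cod C f \<in> Obj C"
    and Id_in: "\<And>x. x \<in> Obj C \<Longrightarrow> Id C x \<in> Arr C"
    and Comp_in: "\<And>f g. \<lbrakk>f \<in> Arr C; g \<in> Arr C; Cod C f = Dom C g\<rbrakk> \<Longrightarrow> Comp C g f \<in> Arr C"
    and Dom: "\<And>f. f \<in> Arr C \<Longrightarrow> Dom D (Fm f) = Fo (Dom C f)"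
    and Cod: "\<And>f. f \<in> Arr C \<Longrightarrow> Cod D (Fm f) = Fo (Cod C f)"
    and Id: "\<And>x. x \<in> Obj C \<Longrightarrow> Fm (Id C x) = Id D (Fo x)"
    and Comp: "\<And>f g. \<lbrakk>f \<in> Arr C; g \<in> Arr C; Cod C f = Dom C g\<rbrakk>
      \<Longrightarrow> Fm (Comp C g f) = Comp D (Fm g) (Fm f)"
  shows "isomorphic_categories C D"
proof -
  interpret D: category D by fact
  have Fo_in: "Fo x \<in> Obj D" if "x \<in> Obj C" for x
    using Fo that by (rule bij_betwE[rule_format])
  have Fm_in: "Fm f \<in> Arr D" if "f \<in> Arr C" for f
    using Fm that by (rule bij_betwE[rule_format])
  have Fo_eqI: "x = y" if "Fo x = Fo y" "x \<in> Obj C" "y \<in> Obj C" for x y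
    using that bij_betw_imp_inj_on[OF Fo] by (simp add: inj_on_eq_iff)
  have Fm_eqI: "f = g" if "Fm f = Fm g" "f \<in> Arr C" "g \<in> Arr C" for f g
    using that bij_betw_imp_inj_on[OF Fm] by (simp add: inj_on_eq_iff)
  have Dom_Id: "Dom C (Id C x) = x" if "x \<in> Obj C" for x
    using that by (intro Fo_eqI Dom_in Id_in)
      (simp_all add: Dom[symmetric] Id Id_in D.Dom_Id Fo_in)
  have Cod_Id: "Cod C (Id C x) = x" if "x \<in> Obj C" for x
    using that by (intro Fo_eqI Cod_in Id_in)
      (simp_all add: Cod[symmetric] Id Id_in D.Cod_Id Fo_in)
  have DC: "Cod D (Fm f) = Dom D (Fm g)" if "f \<in> Arr C" "g \<in> Arr C" "Cod C f = Dom C g" for f g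
    using that by (simp add: Dom Cod)
  have Dom_Comp: "Dom C (Comp C g f) = Dom C f"
    if "f \<in> Arr C" "g \<in> Arr C" "Cod C f = Dom C g" for f g
    using that by (intro Fo_eqI Dom_in Comp_in)
      (simp_all add: Dom[symmetric] Comp Comp_in D.Dom_Comp Fm_in DC Dom_in Cod_in)
  have Cod_Comp: "Cod C (Comp C g f) = Cod C g"
    if "f \<in> Arr C" "g \<in> Arr C" "Cod C f = Dom C g" for f g
    using that by (intro Fo_eqI Cod_in Comp_in)
      (simp_all add: Cod[symmetric] Comp Comp_in D.Cod_Comp Fm_in DC Dom_in Cod_in)
  interpret C: category C
  proof
    fix f assume f: "f \<in> Arr C"
    show "Comp C f (Id C (Dom C f)) = f"
      by (rule Fm_eqI)
        (use f in \<open>simp_all add: Comp Comp_in Id Id_in Dom_in Cod_Id Dom[symmetric]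
          D.Comp_Id_right Fm_in\<close>)
    show "Comp C (Id C (Cod C f)) f = f"
      by (rule Fm_eqI)
        (use f in \<open>simp_all add: Comp Comp_in Id Id_in Cod_in Dom_Id Cod[symmetric]
          D.Comp_Id_left Fm_in\<close>)
  next
    fix f g h
    assume "f \<in> Arr C" "g \<in> Arr C" "h \<in> Arr C" "Cod C f = Dom C g" "Cod C g = Dom C h"
    then show "Comp C h (Comp C g f) = Comp C (Comp C h g) f"
      by (intro Fm_eqI) (simp_all add: Comp Comp_in Dom_Comp Cod_Comp D.Comp_assoc Fm_in DC)
  qed (fact Dom_in Cod_in Id_in Dom_Id Cod_Id Comp_in Dom_Comp Cod_Comp)+
  define Go where "Go = inv_into (Obj C) Fo"
  define Gm where "Gm = inv_into (Arr C) Fm"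
  have GF: "Go (Fo x) = x" if "x \<in> Obj C" for x
    unfolding Go_def using Fo that by (rule bij_betw_inv_into_left)
  have FG: "Fo (Go y) = y" if "y \<in> Obj D" for y
    unfolding Go_def using Fo that by (rule bij_betw_inv_into_right)
  have GFm: "Gm (Fm f) = f" if "f \<in> Arr C" for f
    unfolding Gm_def using Fm that by (rule bij_betw_inv_into_left)
  have FGm: "Fm (Gm g) = g" if "g \<in> Arr D" for g
    unfolding Gm_def using Fm that by (rule bij_betw_inv_into_right)
  have Go_in: "Go y \<in> Obj C" if "y \<in> Obj D" for y
    unfolding Go_def using bij_betw_inv_into[OF Fo] that by (rule bij_betwE[rule_format])
  have Gm_in: "Gm g \<in> Arr C" if "g \<in> Arr D" for g
    unfolding Gm_def using bij_betw_inv_into[OF Fm] that by (rule bij_betwE[rule_format])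
  have "cat_functor C D Fo Fm"
    by unfold_locales (fact Fo_in Fm_in Dom Cod Id Comp)+
  moreover
  have DomG: "Dom C (Gm g) = Go (Dom D g)" if "g \<in> Arr D" for g
    using GF[OF Dom_in[OF Gm_in[OF that]]] Dom[OF Gm_in[OF that]] that by (simp add: FGm)
  have CodG: "Cod C (Gm g) = Go (Cod D g)" if "g \<in> Arr D" for g
    using GF[OF Cod_in[OF Gm_in[OF that]]] Cod[OF Gm_in[OF that]] that by (simp add: FGm)
  have "cat_functor D C Go Gm"
  proof
    fix y assume "y \<in> Obj D"
    then show "Gm (Id D y) = Id C (Go y)"
      by (intro Fm_eqI) (simp_all add: FGm D.Id_in Id Go_in FG Gm_in Id_in)
  next
    fix f g assume "f \<in> Arr D" "g \<in> Arr D" "Cod D f = Dom D g"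
    then show "Gm (Comp D g f) = Comp C (Gm g) (Gm f)"
      by (intro Fm_eqI) (simp_all add: FGm D.Comp_in Comp Gm_in DomG CodG Comp_in)
  qed (fact Go_in Gm_in DomG CodG)+
  ultimately show ?thesis
    unfolding isomorphic_categories_def using GF FG GFm FGm by blast
qed

lemma cat_functor_comp:
  assumes "cat_functor C D Fo Fm" "cat_functor D E Go Gm"
  shows "cat_functor C E (Go \<circ> Fo) (Gm \<circ> Fm)"
proof -
  interpret F: cat_functor C D Fo Fm by fact
  interpret G: cat_functor D E Go Gm by fact
  show ?thesis
    by unfold_locales
      (simp_all add: F.Fo_in F.Fm_in F.Dom_Fm F.Cod_Fm F.Fm_Id F.Fm_Comp
        G.Fo_in G.Fm_in G.Dom_Fm G.Cod_Fm G.Fm_Id G.Fm_Comp)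
qed

lemma isomorphic_categories_trans:
  assumes "isomorphic_categories C D" "isomorphic_categories D E"
  shows "isomorphic_categories C E"
proof -
  obtain Fo Fm Fo' Fm' where F: "cat_functor C D Fo Fm" "cat_functor D C Fo' Fm'"
    "\<forall>x \<in> Obj C. Fo' (Fo x) = x" "\<forall>f \<in> Arr C. Fm' (Fm f) = f"
    "\<forall>y \<in> Obj D. Fo (Fo' y) = y" "\<forall>g \<in> Arr D. Fm (Fm' g) = g"
    using assms(1) unfolding isomorphic_categories_def by blast
  obtain Go Gm Go' Gm' where G: "cat_functor D E Go Gm" "cat_functor E D Go' Gm'"
    "\<forall>x \<in> Obj D. Go' (Go x) = x" "\<forall>f \<in> Arr D. Gm' (Gm f) = f"
    "\<forall>y \<in> Obj E. Go (Go' y) = y" "\<forall>g \<in> Arr E. Gm (Gm' g) = g"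
    using assms(2) unfolding isomorphic_categories_def by blast
  have "(\<forall>x \<in> Obj C. (Fo' \<circ> Go') ((Go \<circ> Fo) x) = x) \<and> (\<forall>f \<in> Arr C. (Fm' \<circ> Gm') ((Gm \<circ> Fm) f) = f)"
    using F G(3,4) by (simp add: cat_functor.Fo_in cat_functor.Fm_in)
  moreover
  have "(\<forall>y \<in> Obj E. (Go \<circ> Fo) ((Fo' \<circ> Go') y) = y) \<and> (\<forall>g \<in> Arr E. (Gm \<circ> Fm) ((Fm' \<circ> Gm') g) = g)"
    using F(5,6) G by (simp add: cat_functor.Fo_in cat_functor.Fm_in)
  ultimately show ?thesis
    unfolding isomorphic_categories_def
    using cat_functor_comp[OF F(1) G(1)] cat_functor_comp[OF G(2) F(2)] by blast
qed

lemma isomorphic_categories_imp_category: "isomorphic_categories C D \<Longrightarrow> category C"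
  unfolding isomorphic_categories_def cat_functor_def by blast

lemma category_Simplex: "category Simplex"
proof (unfold_locales, goal_cases)
  case (6 f g)
  then show ?case
    by (auto simp: Simplex_def compose_def mono_on_def PiE_iff extensional_def split: prod.splits)
next
  case (9 f)
  then show ?case
    by (auto simp: Simplex_def compose_def PiE_iff extensional_def fun_eq_iff)
next
  case (10 f)
  then show ?case
    by (auto simp: Simplex_def compose_def PiE_iff extensional_def fun_eq_iff)
next
  case (11 f g h)
  then show ?case
    by (auto simp: Simplex_def compose_def PiE_iff fun_eq_iff)
qed (auto simp: Simplex_def mono_on_def)

section \<open>Cutting lists into blocks\<close>

lemma concat_take_blocks: "concat (take j (blocks ns xs)) = take (sum_list (take j ns)) xs"
proof (induction ns arbitrary: j xs)
  case (Cons n ns)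
  then show ?case by (cases j) (simp_all add: take_add)
qed simp

lemma map_length_blocks: "sum_list ns \<le> length xs \<Longrightarrow> map length (blocks ns xs) = ns"
  by (induction ns arbitrary: xs) simp_all

lemma length_blocks: "length (blocks ns xs) = length ns"
  by (induction ns arbitrary: xs) simp_all

lemma set_blocks: "bs \<in> set (blocks ns xs) \<Longrightarrow> set bs \<subseteq> set xs"
  by (induction ns arbitrary: xs) (auto dest: in_set_takeD in_set_dropD)

section \<open>The monotone map of a tuple\<close>

definition tuple_map :: "'a operad \<Rightarrow> 'a tuple \<Rightarrow> nat \<times> (nat \<Rightarrow> nat) \<times> nat" where
  "tuple_map P = (\<lambda>(q0, i, qs).
    (length qs, \<lambda>j\<in>{0..length qs}. i - 1 + sum_list (map (arity P) (take j qs)),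
     arity P q0 - 1 + sum_list (map (arity P) qs)))"

lemma sum_list_take_mono: "j \<le> k \<Longrightarrow> sum_list (take j xs) \<le> sum_list (take k (xs :: nat list))"
  by (auto simp: le_iff_add take_add)

lemma sum_list_take_le: "sum_list (take j xs) \<le> sum_list (xs :: nat list)"
  by (metis append_take_drop_id le_add1 sum_list_append)

lemma tuple_map_in:
  assumes "x \<in> tuples P"
  shows "tuple_map P x \<in> Arr Simplex"
proof (cases x)
  case (fields q0 i qs)
  let ?f = "\<lambda>j. i - 1 + sum_list (map (arity P) (take j qs))"
  have "?f j \<le> arity P q0 - 1 + sum_list (map (arity P) qs)" for j
    unfolding take_map[symmetric]
    using assms by (intro add_mono sum_list_take_le) (simp add: fields tuples_def diff_le_mono)
  moreover have "?f j \<le> ?f k" if "j \<le> k" for j k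
    unfolding take_map[symmetric] using that by (intro add_mono sum_list_take_mono) simp_all
  ultimately show ?thesis
    by (simp add: fields tuple_map_def Simplex_def mono_on_def)
qed

context planar_operad
begin

lemma pcomp_in_arity:
  assumes "p \<in> ops P" "q \<in> ops P" "1 \<le> i" "i \<le> arity P p"
  shows "pcomp P p i q \<in> ops P \<and> arity P (pcomp P p i q) = arity P p - 1 + arity P q"
proof -
  let ?qs = "replicate (i - 1) (idop P) @ [q] @ replicate (arity P p - i) (idop P)"
  have "set ?qs \<subseteq> ops P" "length ?qs = arity P p"
    using assms idop_in by auto
  then show ?thesis
    using assms gam_in[of p ?qs] arity_gam[of p ?qs]
    by (simp add: pcomp_def arity_idop sum_list_replicate)
qed

text \<open>Arities are additive under composition, so an initial segment of the composed upper vertices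
  has as many inputs as the corresponding initial segment of the list that was cut into blocks.\<close>

lemma map2_gam_blocks:
  assumes qs: "set qs \<subseteq> ops P" and xs: "set xs \<subseteq> ops P"
    and len: "sum_list (map (arity P) qs) \<le> length xs"
  defines "bss \<equiv> blocks (map (arity P) qs) xs"
  shows "set (map2 (gam P) qs bss) \<subseteq> ops P"
    and "sum_list (map (arity P) (take j (map2 (gam P) qs bss))) =
      sum_list (map (arity P) (take (sum_list (map (arity P) (take j qs))) xs))"
proof -
  have len': "length qs = length bss" by (simp add: bss_def length_blocks)
  have block: "set (bss ! l) \<subseteq> ops P \<and> length (bss ! l) = arity P (qs ! l)" if "l < length qs" for l
  proof
    show "set (bss ! l) \<subseteq> ops P"
      using set_blocks[of "bss ! l" "map (arity P) qs" xs] xs that len' by (fastforce simp: bss_def)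
    have "map length bss ! l = arity P (qs ! l)"
      using map_length_blocks[OF len] that by (simp add: bss_def)
    then show "length (bss ! l) = arity P (qs ! l)"
      using that len' by simp
  qed
  have q: "qs ! l \<in> ops P" if "l < length qs" for l
    using qs that by auto
  show "set (map2 (gam P) qs bss) \<subseteq> ops P"
    using block q len' by (auto simp: set_zip intro!: gam_in)
  have "map (arity P) (map2 (gam P) qs bss) = map (sum_list \<circ> map (arity P)) bss"
    by (rule nth_equalityI) (use block q len' in \<open>auto simp: arity_gam\<close>)
  then have "map (arity P) (take j (map2 (gam P) qs bss)) = map (sum_list \<circ> map (arity P)) (take j bss)"
    by (metis take_map)
  also have "sum_list \<dots> = sum_list (map (arity P) (concat (take j bss)))"
    by (simp add: map_concat sum_list_concat)
  also have "concat (take j bss) = take (sum_list (map (arity P) (take j qs))) xs"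
    by (simp add: bss_def concat_take_blocks take_map)
  finally show "sum_list (map (arity P) (take j (map2 (gam P) qs bss))) =
      sum_list (map (arity P) (take (sum_list (map (arity P) (take j qs))) xs))" .
qed

text \<open>Write \<open>f\<close> for the map of the inner tuple \<open>(q0, i, qs)\<close>. The composed maps send
  \<open>j\<close> to \<open>k - 1\<close> plus the arities of the first \<open>f j\<close> members of \<open>rs\<close>. The first
  \<open>i - 1\<close> of these members are grafted onto the lower vertex, where their arities shift the
  position \<open>k\<close> of the source vertex; the others are exactly the first \<open>j\<close> blocks, whose
  arities add up to those of the first \<open>j\<close> upper vertices of the composite. So both
  constructions count the same leaves.\<close>

lemma tuple_map_comp:
  assumes "(q0, i, qs) \<in> tuples P" "(r0, k, rs) \<in> tuples P"
    and len: "length rs = arity P q0 - 1 + sum_list (map (arity P) qs)"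
  shows "comp_tuple P (r0, k, rs) (q0, i, qs) \<in> tuples P"
    and "tuple_map P (comp_tuple P (r0, k, rs) (q0, i, qs)) =
      Comp Simplex (tuple_map P (r0, k, rs)) (tuple_map P (q0, i, qs))"
proof -
  let ?A = "\<lambda>xs. sum_list (map (arity P) xs)"
  define as where "as = take (i - 1) rs"
  define xs where "xs = drop (i - 1) rs"
  define cs where "cs = drop (i - 1 + ?A qs) rs"
  define ts where "ts = map2 (gam P) qs (blocks (map (arity P) qs) xs)"
  define s where "s = gam P q0 (as @ [idop P] @ cs)"
  have q: "q0 \<in> ops P" "1 \<le> i" "i \<le> arity P q0" "set qs \<subseteq> ops P"
    and r: "r0 \<in> ops P" "1 \<le> k" "k \<le> arity P r0" "set rs \<subseteq> ops P"
    using assms by (auto simp: tuples_def)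
  have as: "set as \<subseteq> ops P" and cs: "set cs \<subseteq> ops P" and xs: "set xs \<subseteq> ops P"
    using r(4) by (auto simp: as_def cs_def xs_def dest: in_set_takeD in_set_dropD)
  have "length (as @ [idop P] @ cs) = arity P q0"
    using q len by (auto simp: as_def cs_def)
  moreover have "set (as @ [idop P] @ cs) \<subseteq> ops P"
    using as cs idop_in by auto
  ultimately have s: "s \<in> ops P" "arity P s = ?A as + 1 + ?A cs"
    using q(1) gam_in[of q0 "as @ [idop P] @ cs"] arity_gam[of q0 "as @ [idop P] @ cs"]
    by (simp_all add: s_def arity_idop)
  have "?A qs \<le> length xs"
    using q len by (simp add: xs_def)
  note ts = map2_gam_blocks[OF q(4) xs this, folded ts_def]
  have len_ts: "length ts = length qs"
    by (simp add: ts_def length_blocks)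
  have leaves: "?A (take (i - 1 + n) rs) = ?A as + ?A (take n xs)" for n
    by (simp add: as_def xs_def take_add)
  have all: "?A rs = ?A as + ?A ts + ?A cs"
  proof -
    have "?A rs = ?A (take (i - 1 + ?A qs) rs) + ?A cs"
      by (metis append_take_drop_id cs_def map_append sum_list_append)
    then show ?thesis
      using ts(2)[of "length qs"] leaves[of "?A qs"] by (simp add: len_ts)
  qed
  have comp: "comp_tuple P (r0, k, rs) (q0, i, qs) = (pcomp P r0 k s, k + ?A as, ts)"
    by (simp add: comp_tuple_def Let_def as_def cs_def xs_def ts_def s_def)
  note pc = pcomp_in_arity[OF r(1) s(1) r(2,3)]
  show "comp_tuple P (r0, k, rs) (q0, i, qs) \<in> tuples P"
    unfolding comp using pc ts(1) r s(2) by (simp add: tuples_def)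
  have in_range: "i - 1 + ?A (take j qs) \<le> length rs" for j
    using sum_list_take_le[of j "map (arity P) qs"] q len by (simp add: take_map)
  have "(k + ?A as) - 1 + ?A (take j ts) = k - 1 + ?A (take (i - 1 + ?A (take j qs)) rs)" for j
    using r(2) leaves[of "?A (take j qs)"] by (simp add: ts(2))
  moreover have "arity P (pcomp P r0 k s) - 1 + ?A ts = arity P r0 - 1 + ?A rs"
    using pc s(2) all by simp
  ultimately show "tuple_map P (comp_tuple P (r0, k, rs) (q0, i, qs)) =
      Comp Simplex (tuple_map P (r0, k, rs)) (tuple_map P (q0, i, qs))"
    unfolding comp using in_range
    by (auto simp: tuple_map_def Simplex_def len_ts compose_def fun_eq_iff)
qed

lemma id_tuple_in: "id_tuple P n \<in> tuples P"
  using idop_in by (auto simp: id_tuple_def tuples_def arity_idop)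

lemma tuple_map_id: "tuple_map P (id_tuple P n) = Id Simplex n"
  by (auto simp: tuple_map_def id_tuple_def Simplex_def arity_idop sum_list_replicate fun_eq_iff min_def)

end

section \<open>The terminal operad\<close>

context uAs_pl
begin

lemma inj_tuple_map: "inj_on (tuple_map P) (tuples P)"
proof (rule inj_onI, unfold split_paired_all)
  fix q0 i qs r0 k rs
  assume "(q0, i, qs) \<in> tuples P" "(r0, k, rs) \<in> tuples P"
    and eq: "tuple_map P (q0, i, qs) = tuple_map P (r0, k, rs)"
  then have q: "q0 \<in> ops P" "1 \<le> i" "i \<le> arity P q0" "set qs \<subseteq> ops P"
    and r: "r0 \<in> ops P" "1 \<le> k" "k \<le> arity P r0" "set rs \<subseteq> ops P"
    by (auto simp: tuples_def)
  let ?S = "\<lambda>qs j. sum_list (map (arity P) (take j qs))"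
  have len: "length qs = length rs"
    using eq by (simp add: tuple_map_def)
  have val: "i - 1 + ?S qs j = k - 1 + ?S rs j" if "j \<le> length rs" for j
  proof -
    have "(fst (snd (tuple_map P (q0, i, qs)))) j = (fst (snd (tuple_map P (r0, k, rs)))) j"
      by (simp only: eq)
    then show ?thesis using that len by (simp add: tuple_map_def)
  qed
  have i: "i = k"
    using val[of 0] q(2) r(2) by simp
  have qs: "qs = rs"
  proof (rule nth_equalityI[OF len])
    fix j assume j: "j < length qs"
    have "arity P (qs ! j) = arity P (rs ! j)"
      using val[of j] val[of "Suc j"] j len i by (simp add: take_Suc_conv_app_nth)
    then show "qs ! j = rs ! j"
      using j len q(4) r(4) by (intro op_eqI) auto
  qed
  then have "arity P q0 = arity P r0"
    using eq q(2,3) r(2,3) by (auto simp: tuple_map_def)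
  then have "q0 = r0"
    using q(1) r(1) by (simp add: op_eqI)
  then show "(q0, i, qs) = (r0, k, rs)"
    using i qs by simp
qed

text \<open>The upper vertices have the increments of \<open>f\<close> as arities; the lower vertex needs \<open>f 0\<close>
  inputs to the left of the marked one and \<open>n - f m\<close> to the right of it.\<close>

lemma surj_tuple_map:
  assumes "(m, f, n) \<in> Arr Simplex"
  shows "(m, f, n) \<in> tuple_map P ` tuples P"
proof -
  obtain mu where mu: "\<And>n. mu n \<in> ops P" "\<And>n. arity P (mu n) = n"
    using unique_op by metis
  have f: "f \<in> {0..m} \<rightarrow>\<^sub>E {0..n}" and mono: "\<And>a b. \<lbrakk>a \<le> b; b \<le> m\<rbrakk> \<Longrightarrow> f a \<le> f b"
    using assms by (auto simp: Simplex_def mono_on_def)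
  have bound: "f j \<le> n" if "j \<le> m" for j
    using f that by auto
  define qs where "qs = map (\<lambda>j. mu (f (Suc j) - f j)) [0..<m]"
  define q0 where "q0 = mu (Suc (f 0) + (n - f m))"
  have sums: "f 0 + sum_list (map (arity P) (take j qs)) = f j" if "j \<le> m" for j
    using that
  proof (induction j)
    case (Suc j)
    then show ?case
      using mono[of j "Suc j"] by (simp add: take_Suc_conv_app_nth qs_def mu)
  qed simp
  have len: "length qs = m" by (simp add: qs_def)
  have "(q0, Suc (f 0), qs) \<in> tuples P"
    by (auto simp: tuples_def q0_def qs_def mu)
  moreover have "arity P q0 - 1 + sum_list (map (arity P) qs) = n"
    using sums[of m] bound[of m] len by (simp add: q0_def mu)
  then have "tuple_map P (q0, Suc (f 0), qs) = (m, f, n)"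
    using sums f len
    by (auto simp: tuple_map_def fun_eq_iff PiE_iff extensional_def)
  ultimately show ?thesis
    by (rule image_eqI[OF sym, rotated])
qed

lemma bij_tuple_map: "bij_betw (tuple_map P) (tuples P) (Arr Simplex)"
  unfolding bij_betw_def using inj_tuple_map surj_tuple_map tuple_map_in by auto

lemma Env_iso_Simplex: "isomorphic_categories (Env P) Simplex"
proof (rule isomorphic_categoriesI[where Fo = id and Fm = "tuple_map P"])
  show "bij_betw (tuple_map P) (Arr (Env P)) (Arr Simplex)"
    using bij_tuple_map by (simp add: Env_def)
next
  show "tuple_map P (Id (Env P) n) = Id Simplex (id n)" for n
    by (simp add: Env_def tuple_map_id)
next
  fix x y assume "x \<in> Arr (Env P)" "y \<in> Arr (Env P)" "Cod (Env P) x = Dom (Env P) y"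
  then show "Comp (Env P) y x \<in> Arr (Env P)"
    and "tuple_map P (Comp (Env P) y x) = Comp Simplex (tuple_map P y) (tuple_map P x)"
    by (cases x; cases y; force simp: Env_def intro: tuple_map_comp)+
qed (fact category_Simplex, auto simp: Env_def Simplex_def id_tuple_in tuple_map_def)

text \<open>Forgetting the source operation of an arrow loses nothing, since the number of upper
  vertices of the tuple is its arity.\<close>

lemma Tw_iso_Env: "isomorphic_categories (Tw P) (Env P)"
proof (rule isomorphic_categoriesI[where Fo = "arity P" and Fm = snd])
  show "category (Env P)"
    using Env_iso_Simplex by (rule isomorphic_categories_imp_category)
  show "bij_betw (arity P) (Obj (Tw P)) (Obj (Env P))"
    unfolding bij_betw_def inj_on_def Tw_def Env_def using unique_op op_eqI by (auto simp: image_iff) metis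
  show "bij_betw snd (Arr (Tw P)) (Arr (Env P))"
    unfolding bij_betw_def
  proof
    show "inj_on snd (Arr (Tw P))"
      by (auto simp: inj_on_def Tw_def intro: op_eqI)
    show "snd ` Arr (Tw P) = Arr (Env P)"
    proof
      show "Arr (Env P) \<subseteq> snd ` Arr (Tw P)"
      proof
        fix x assume x: "x \<in> Arr (Env P)"
        obtain q0 i qs where [simp]: "x = (q0, i, qs)" by (cases x)
        obtain p where "p \<in> ops P" "arity P p = length qs"
          using unique_op by metis
        with x have "(p, x) \<in> Arr (Tw P)"
          by (simp add: Tw_def Env_def)
        then show "x \<in> snd ` Arr (Tw P)" by force
      qed
    qed (auto simp: Tw_def Env_def)
  qed
next
  have target: "pcomp P q0 i (gam P p qs) \<in> ops P \<and>
      arity P (pcomp P q0 i (gam P p qs)) = arity P q0 - 1 + sum_list (map (arity P) qs)"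
    if "p \<in> ops P" "(q0, i, qs) \<in> tuples P" "length qs = arity P p" for p q0 i qs
    using that pcomp_in_arity[of q0 "gam P p qs" i] gam_in[of p qs] arity_gam[of p qs]
    by (auto simp: tuples_def)
  fix f assume f: "f \<in> Arr (Tw P)"
  show "Cod (Tw P) f \<in> Obj (Tw P)" "Cod (Env P) (snd f) = arity P (Cod (Tw P) f)"
    using f target by (auto simp: Tw_def Env_def)
  fix g assume g: "g \<in> Arr (Tw P)" and fg: "Cod (Tw P) f = Dom (Tw P) g"
  obtain p q0 i qs where [simp]: "f = (p, q0, i, qs)" by (cases f)
  obtain t r0 k rs where [simp]: "g = (t, r0, k, rs)" by (cases g)
  have "length rs = arity P q0 - 1 + sum_list (map (arity P) qs)"
    using f g fg target[of p q0 i qs] by (auto simp: Tw_def)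
  then have "comp_tuple P (r0, k, rs) (q0, i, qs) \<in> tuples P"
    using f g by (intro tuple_map_comp) (auto simp: Tw_def)
  moreover have "length (snd (snd (comp_tuple P (r0, k, rs) (q0, i, qs)))) = length qs"
    by (simp add: comp_tuple_def Let_def length_blocks)
  ultimately show "Comp (Tw P) g f \<in> Arr (Tw P)"
    using f by (cases "comp_tuple P (r0, k, rs) (q0, i, qs)") (simp add: Tw_def)
  show "snd (Comp (Tw P) g f) = Comp (Env P) (snd g) (snd f)"
    by (simp add: Tw_def Env_def)
qed (auto simp: Tw_def Env_def id_tuple_def idop_in tuples_def arity_idop)

end

theorem proposition2p26:
  fixes P :: "'a operad"
  assumes "uAs_pl P"
  shows "isomorphic_categories (Tw P) Simplex \<and> isomorphic_categories (Env P) Simplex"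
proof -
  interpret uAs_pl P by fact
  show ?thesis
    using isomorphic_categories_trans[OF Tw_iso_Env Env_iso_Simplex] Env_iso_Simplex by blast
qed

end
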